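(* Let $h\geq 2$ be an integer and let $\mathbb{F}$ be a field whose characteristic is either zero or a prime $p>h$. Then the set $$\mathcal{A}:=\{(x,x^2,\ldots,x^h):x\in\mathbb{F}\}$$ is a $B_h$ set on the abelian group $(\mathbb{F}^h,+)$.
   Context: Let $(G,+)$ be an abelian group, and let $h\ge 2$, $g\ge 1$ be integers. A subset $\mathcal{A}\subseteq G$ is a $B_h[g]$ set on $G$ if every $x\in G$ can be written in at most $g$ ways as a sum of $h$ (not necessarily distinct) elements of $\mathcal{A}$, where representations $x=a_1+\cdots+a_h$ with $a_1,\ldots,a_h\in\mathcal{A}$ that differ only by rearrangement of the summands are counted as the same. A $B_h$ set is a $B_h[1]$ set. $\mathbb{F}^h$ denotes the set of all $h$-tuples of elements of $\mathbb{F}$ with componentwise addition. *)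

theory Defs
  imports "Jordan_Normal_Form.Matrix" "HOL-Computational_Algebra.Primes"
begin

text \<open>
  Abelian groups are the (multiplicatively written) \<open>comm_group\<close>s of HOL-Algebra, so the
  sum $a_1 + \cdots + a_h$ in the group is the \<open>foldr\<close>-product of a list of length \<open>h\<close>.
  Taking \<open>mset\<close> of the list of summands identifies representations that differ only by
  a rearrangement.
\<close>

definition sum_reps ::
    "('a, 'm) monoid_scheme \<Rightarrow> 'a set \<Rightarrow> nat \<Rightarrow> 'a \<Rightarrow> 'a multiset set" where
  "sum_reps G A h x =
     {mset as | as. length as = h \<and> set as \<subseteq> A \<and> foldr (\<otimes>\<^bsub>G\<^esub>) as \<one>\<^bsub>G\<^esub> = x}"

text \<open>
  Finiteness is stated separately because \<open>card\<close> of an infinite set is \<open>0\<close>. The notion is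
  intended for \<open>h \<ge> 2\<close> and \<open>g \<ge> 1\<close>.
\<close>

definition Bhg_set :: "('a, 'm) monoid_scheme \<Rightarrow> nat \<Rightarrow> nat \<Rightarrow> 'a set \<Rightarrow> bool" where
  "Bhg_set G h g A \<longleftrightarrow>
     comm_group G \<and> A \<subseteq> carrier G \<and>
     (\<forall>x\<in>carrier G. finite (sum_reps G A h x) \<and> card (sum_reps G A h x) \<le> g)"

definition Bh_set :: "('a, 'm) monoid_scheme \<Rightarrow> nat \<Rightarrow> 'a set \<Rightarrow> bool" where
  "Bh_set G h A \<longleftrightarrow> Bhg_set G h 1 A"

text \<open>
  The points $(x, x^2, \ldots, x^h)$; vectors are indexed from \<open>0\<close>, hence the shift in the exponent.
\<close>

definition moment_curve :: "nat \<Rightarrow> 'a::field vec set" where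
  "moment_curve h = {vec h (\<lambda>i. x ^ (i + 1)) | x. x \<in> UNIV}"

end

theory Submission
  imports Defs "HOL-Computational_Algebra.Polynomial_FPS"
begin

unbundle fps_syntax

text \<open>
  If $\prod_j (1 - a_j X)$ is denoted by \<open>P\<close> and the power sums of the $a_j$ by $p_k$, then
  $P' = -P \sum_k p_{k+1} X^k$. Comparing coefficients of $X^k$ for $k < h$ recovers \<open>P\<close> from
  $p_1, \ldots, p_h$, because one only has to divide by $1, \ldots, h$, which are nonzero in the field.
  The polynomial \<open>P\<close>, together with its number of factors, determines the multiset of the $a_j$.
\<close>

text \<open>Reflection turns each factor X - a into 1 - a X, so this is P. Starting from the monic
  product keeps the roots within reach of \<open>proots\<close>; power series make room for the
  infinite generating function of the power sums.\<close>

definition root_fps :: "'a::field multiset \<Rightarrow> 'a fps" where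
  "root_fps M = fps_of_poly (reflect_poly (\<Prod>a\<in>#M. [:-a, 1:]))"

definition power_sum :: "nat \<Rightarrow> 'a::field multiset \<Rightarrow> 'a" where
  "power_sum k M = (\<Sum>a\<in>#M. a ^ k)"

lemma root_fps_empty [simp]: "root_fps {#} = 1"
  by (simp add: root_fps_def)

lemma root_fps_add_mset:
  "root_fps (add_mset a M) = (1 - fps_const a * fps_X) * root_fps M"
proof -
  have "reflect_poly [:-a, 1:] = [:1, -a:]"
    by (simp add: reflect_poly_def)
  then have "fps_of_poly (reflect_poly [:-a, 1:]) = 1 - fps_const a * fps_X"
    by (simp add: fps_of_poly_pCons)
  then show ?thesis
    unfolding root_fps_def image_mset_add_mset prod_mset.add_mset reflect_poly_mult fps_of_poly_mult
    by simp
qed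

lemma degree_prod_roots: "degree (\<Prod>a\<in>#M. [:-a, 1::'a::field:]) = size M"
proof (induction M)
  case (add a M)
  have "(\<Prod>a\<in>#M. [:-a, 1::'a:]) \<noteq> 0"
    by (auto simp: prod_mset_zero_iff)
  then show ?case
    using add by (simp add: degree_mult_eq del: mult_pCons_left)
qed simp

lemma proots_prod_roots: "proots (\<Prod>a\<in>#M. [:-a, 1::'a::field:]) = M"
proof (induction M)
  case (add a M)
  have "(\<Prod>a\<in>#M. [:-a, 1::'a:]) \<noteq> 0"
    by (auto simp: prod_mset_zero_iff)
  then show ?case
    using add by (simp add: proots_mult del: mult_pCons_left)
qed simp

text \<open>An entry 0 contributes the factor 1 to P and so leaves no trace there. The common size
  supplies the degree of the monic product, whose coefficients are then those of P in reverse
  order.\<close>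

lemma root_fps_inject:
  assumes "root_fps M = root_fps N" and "size M = size N"
  shows "M = N"
proof -
  let ?Q = "\<lambda>M. \<Prod>a\<in>#M. [:-a, 1::'a:]"
  have refl: "reflect_poly (?Q M) = reflect_poly (?Q N)"
    using assms(1) by (simp add: root_fps_def fps_of_poly_eq_iff)
  have "?Q M = ?Q N"
  proof (rule poly_eqI)
    fix n
    show "coeff (?Q M) n = coeff (?Q N) n"
    proof (cases "n \<le> size M")
      case True
      have "coeff (?Q K) n = coeff (reflect_poly (?Q K)) (size M - n)" if "size K = size M" for K
        using that True by (simp add: coeff_reflect_poly degree_prod_roots)
      then show ?thesis
        using refl assms(2) by simp
    qed (use assms(2) in \<open>simp add: coeff_eq_0 degree_prod_roots\<close>)
  qed
  then show ?thesis
    by (metis proots_prod_roots)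
qed

text \<open>Logarithmic derivative of P: the factor 1 - a X contributes -a / (1 - a X), a geometric
  series with coefficients -a^(k+1). The induction is the product rule.\<close>

lemma fps_deriv_root_fps:
  "fps_deriv (root_fps M) = - root_fps M * Abs_fps (\<lambda>k. power_sum (Suc k) M)"
proof (induction M)
  case empty
  show ?case
    by (simp add: power_sum_def fps_eq_iff)
next
  case (add a M)
  let ?A = "Abs_fps (\<lambda>k. a ^ Suc k)"
  let ?S = "Abs_fps (\<lambda>k. power_sum (Suc k) M)"
  have geom: "(1 - fps_const a * fps_X) * ?A = fps_const a"
  proof (rule fps_ext)
    fix n
    show "((1 - fps_const a * fps_X) * ?A) $ n = fps_const a $ n"
      by (cases n) (simp_all add: left_diff_distrib mult.assoc)
  qed
  have S: "Abs_fps (\<lambda>k. power_sum (Suc k) (add_mset a M)) = ?A + ?S"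
    by (simp add: fps_eq_iff power_sum_def)
  have "fps_deriv (root_fps (add_mset a M)) =
      - root_fps M * (fps_const a + (1 - fps_const a * fps_X) * ?S)"
    by (simp add: root_fps_add_mset add.IH algebra_simps)
  \<comment> \<open>Replacing the constant a by (1 - a X) \<open>?A\<close> makes the linear factor
    common to both summands.\<close>
  also have "\<dots> = - root_fps M * ((1 - fps_const a * fps_X) * (?A + ?S))"
    by (simp only: distrib_left geom)
  also have "\<dots> = - root_fps (add_mset a M) * (?A + ?S)"
    by (simp add: root_fps_add_mset mult_ac)
  finally show ?case
    by (simp only: S)
qed

lemma newton_identity:
  "of_nat (Suc k) * root_fps M $ Suc k = - (\<Sum>i=0..k. root_fps M $ i * power_sum (Suc (k - i)) M)"
proof -
  have "of_nat (Suc k) * root_fps M $ Suc k = fps_deriv (root_fps M) $ k"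
    by simp
  also have "\<dots> = - (\<Sum>i=0..k. root_fps M $ i * power_sum (Suc (k - i)) M)"
    by (simp only: fps_deriv_root_fps) (simp add: fps_mult_nth sum_negf)
  finally show ?thesis .
qed

lemma root_fps_nth_0 [simp]: "root_fps M $ 0 = 1"
  by (induction M) (simp_all add: root_fps_add_mset)

lemma root_fps_nth_eq_0: "size M < k \<Longrightarrow> root_fps M $ k = 0"
  by (simp add: root_fps_def coeff_reflect_poly degree_prod_roots)

text \<open>Newton's identity expresses k times the k-th coefficient of P through earlier
  coefficients and the power sums of exponents 1 to k; cancelling k drives a strong induction up to
  h.\<close>

lemma multiset_eq_if_power_sums_eq:
  fixes M N :: "'a::field multiset"
  assumes size: "size M = h" "size N = h"
    and char: "\<And>k. 0 < k \<Longrightarrow> k \<le> h \<Longrightarrow> of_nat k \<noteq> (0::'a)"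
    and sums: "\<And>k. 0 < k \<Longrightarrow> k \<le> h \<Longrightarrow> power_sum k M = power_sum k N"
  shows "M = N"
proof (rule root_fps_inject)
  have "root_fps M $ k = root_fps N $ k" if "k \<le> h" for k
    using that
  proof (induction k rule: less_induct)
    case (less k)
    show ?case
    proof (cases k)
      case (Suc m)
      have "of_nat (Suc m) * root_fps M $ Suc m = of_nat (Suc m) * root_fps N $ Suc m"
        unfolding newton_identity using less Suc sums by (intro arg_cong[of _ _ uminus] sum.cong) auto
      then show ?thesis
        using char[of k] less.prems Suc by (metis mult_left_cancel zero_less_Suc)
    qed simp
  qed
  \<comment> \<open>Beyond h both series vanish, since P has at most h linear factors.\<close>
  then show "root_fps M = root_fps N"
    using size root_fps_nth_eq_0 by (metis fps_ext not_le)
qed (use size in simp)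

definition moment_point :: "nat \<Rightarrow> 'a::field \<Rightarrow> 'a vec" where
  "moment_point h x = vec h (\<lambda>i. x ^ (i + 1))"

text \<open>Translates the group sum of curve points into the first h power sums of their
  parameters.\<close>

lemma foldr_moment_point:
  fixes xs :: "'a::field list"
  shows "foldr (\<otimes>\<^bsub>monoid_vec TYPE('a) h\<^esub>) (map (moment_point h) xs) \<one>\<^bsub>monoid_vec TYPE('a) h\<^esub> =
    vec h (\<lambda>i. power_sum (Suc i) (mset xs))"
  by (induction xs) (auto simp: monoid_vec_def power_sum_def moment_point_def)

theorem theorem1:
  fixes h :: nat
  assumes "h \<ge> 2"
    and "CHAR('a::field) = 0 \<or> (prime CHAR('a) \<and> CHAR('a) > h)"
  shows "Bh_set (monoid_vec TYPE('a) h) h (moment_curve h)"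
proof -
  let ?G = "monoid_vec TYPE('a) h"
  have curve: "moment_curve h = range (moment_point h :: 'a \<Rightarrow> 'a vec)"
    by (auto simp: moment_curve_def moment_point_def)
  \<comment> \<open>The characteristic would have to divide k, but 0 divides only 0 and a prime
    above h divides no positive k \<le> h.\<close>
  have char: "of_nat k \<noteq> (0::'a)" if "0 < k" "k \<le> h" for k
    using that assms(2) by (auto simp: of_nat_eq_0_iff_char_dvd dest: dvd_imp_le)
  have "r = s"
    if r: "r \<in> sum_reps ?G (moment_curve h) h v" and s: "s \<in> sum_reps ?G (moment_curve h) h v"
    for v :: "'a vec" and r s
  proof -
    \<comment> \<open>Representations are compared through their parameters: once the parameter
      multisets agree, so do their images \<open>r\<close> and \<open>s\<close>.\<close>
    have rep: "\<exists>xs. t = image_mset (moment_point h) (mset xs) \<and> length xs = h \<and>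
        v = vec h (\<lambda>i. power_sum (Suc i) (mset xs))"
      if t: "t \<in> sum_reps ?G (moment_curve h) h v" for t
    proof -
      obtain as where as: "t = mset as" "length as = h" "set as \<subseteq> range (moment_point h)"
        "foldr (\<otimes>\<^bsub>?G\<^esub>) as \<one>\<^bsub>?G\<^esub> = v"
        using t by (auto simp: sum_reps_def curve)
      then obtain xs where "as = map (moment_point h) xs"
        by (metis ex_map_conv image_iff subsetD)
      with as show ?thesis
        by (auto simp: foldr_moment_point)
    qed
    obtain xs where xs: "r = image_mset (moment_point h) (mset xs)" "length xs = h"
      "v = vec h (\<lambda>i. power_sum (Suc i) (mset xs))"
      using rep[OF r] by blast
    obtain ys where ys: "s = image_mset (moment_point h) (mset ys)" "length ys = h"
      "v = vec h (\<lambda>i. power_sum (Suc i) (mset ys))"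
      using rep[OF s] by blast
    have "mset xs = mset ys"
    proof (rule multiset_eq_if_power_sums_eq)
      fix k assume "0 < k" "k \<le> h"
      then obtain m where m: "k = Suc m" "m < h"
        by (cases k) auto
      have "v $ m = power_sum k (mset xs)"
        using m by (simp add: xs(3))
      moreover have "v $ m = power_sum k (mset ys)"
        using m by (simp add: ys(3))
      ultimately show "power_sum k (mset xs) = power_sum k (mset ys)"
        by simp
    qed (use xs ys char in auto)
    then show ?thesis
      using xs ys by simp
  qed
  \<comment> \<open>Any two members coincide, so the set is empty or a singleton, which gives
    finiteness too.\<close>
  then have "finite (sum_reps ?G (moment_curve h) h v) \<and> card (sum_reps ?G (moment_curve h) h v) \<le> 1"
    for v
    by (metis card_le_Suc0_iff_eq is_singletonI' is_singleton_def finite.simps One_nat_def)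
  moreover have "comm_group ?G"
    by (rule comm_group_vec)
  moreover have "moment_curve h \<subseteq> carrier ?G"
    by (auto simp: moment_curve_def monoid_vec_def)
  ultimately show ?thesis
    by (simp add: Bh_set_def Bhg_set_def)
qed

end
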